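(* Let $n$, $L$, $\kappa$ be positive integers, let $L_n$ be the largest divisor of $L$ coprime with $n$, let $c:=\mathrm{ord}_{L_n}(n)$, let $m$ be a positive divisor of $c$, and let $\omega$ be any primitive $m$-th root of unity. Then $$\dim E_n(\omega,L,\kappa)=\sum_{j=1}^{c}b_{jm},$$ where $b_j$ is the number of cycles of length $j$ in the Zolotarev graph $Z(n,L)$, which is given by $b_j=\frac1j\sum_{d\mid j}\mu\left(\frac jd\right)\gcd(n^d-1,L)$.
   Context: $\mathcal{R}$ is the complex vector space of rational functions over $\mathbb{C}$ analytic at the origin, identified with their Taylor series; $U_n\left(\sum_{k\ge 0}a(k)x^k\right)=\sum_{k\ge 0}a(nk)x^k$. For positive integers $L,\kappa$, $$\mathcal{R}(L,\kappa)=\left\{f\in\mathcal{R}\mid f(x)=\sum_{k\ge0}k^{\kappa-1}a(k)x^k,\ a(k+L)=a(k)\text{ for all }k\ge 0\right\}$$ (with $0^0=1$), and $E_n(\omega,L,\kappa)=\{f\in\mathcal{R}(L,\kappa)\mid U_n f=n^{\kappa-1}\omega f\}$. $\mathrm{ord}_{L_n}(n)$ is the multiplicative order of $n$ modulo $L_n$ (equal to $1$ if $L_n=1$), and $\mu$ is the M\"obius function. The Zolotarev graph $Z(n,L)$ is the directed graph with node set $\mathbb{Z}/L\mathbb{Z}$ and an edge from $a$ to $b$ exactly when $na\equiv b\pmod L$. A cycle of length $j$ is a set $\{r,nr,\dots,n^{j-1}r\}$ of exactly $j$ distinct nodes with $n^jr\equiv r\pmod L$. *)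

theory Defs
  imports
    "HOL-Computational_Algebra.Computational_Algebra"
    "HOL-Number_Theory.Number_Theory"
    "Graph_Theory.Pair_Digraph"
begin

section \<open>Rational functions analytic at the origin\<close>

global_interpretation fps_space: vector_space "\<lambda>(c::complex) (f::complex fps). fps_const c * f"
  by unfold_locales (simp_all add: fps_eq_iff algebra_simps)

text \<open>A rational function is analytic at \<open>0\<close> iff it can be written with a denominator that does not
  vanish at \<open>0\<close>; the quotient of power series below is then its Taylor series.\<close>

definition rational_at_0 :: "complex fps set" where
  "rational_at_0 =
     {f. \<exists>p q :: complex poly. poly q 0 \<noteq> 0 \<and> f = fps_of_poly p / fps_of_poly q}"

definition U :: "nat \<Rightarrow> complex fps \<Rightarrow> complex fps" where
  "U n f = Abs_fps (\<lambda>k. fps_nth f (n * k))"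

definition quasi_periodic :: "nat \<Rightarrow> nat \<Rightarrow> complex fps set" where
  "quasi_periodic L \<kappa> =
     {f \<in> rational_at_0. \<exists>a :: nat \<Rightarrow> complex.
        f = Abs_fps (\<lambda>k. of_nat k ^ (\<kappa> - 1) * a k) \<and> (\<forall>k. a (k + L) = a k)}"

definition eigenspace :: "nat \<Rightarrow> complex \<Rightarrow> nat \<Rightarrow> nat \<Rightarrow> complex fps set" where
  "eigenspace n \<omega> L \<kappa> =
     {f \<in> quasi_periodic L \<kappa>. U n f = fps_const (of_nat n ^ (\<kappa> - 1) * \<omega>) * f}"

lemma rational_at_0_iff:
  "f \<in> rational_at_0 \<longleftrightarrow>
     (\<exists>p q :: complex poly. poly q 0 \<noteq> 0 \<and> f * fps_of_poly q = fps_of_poly p)"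
proof -
  have "f = fps_of_poly p / fps_of_poly q \<longleftrightarrow> f * fps_of_poly q = fps_of_poly p"
    if "poly q 0 \<noteq> 0" for p q :: "complex poly"
  proof -
    have 0: "fps_nth (fps_of_poly q) 0 \<noteq> 0"
      using that by (simp add: poly_0_coeff_0)
    hence "fps_of_poly q dvd fps_of_poly p"
      using fps_is_unit_iff unit_imp_dvd by blast
    moreover have "fps_of_poly q \<noteq> 0"
      using 0 by auto
    ultimately show ?thesis
      by (metis dvd_div_mult_self nonzero_mult_div_cancel_right)
  qed
  thus ?thesis
    unfolding rational_at_0_def by blast
qed

lemma subspace_rational_at_0: "fps_space.subspace rational_at_0"
  unfolding fps_space.subspace_def
proof (intro conjI ballI allI)
  show "0 \<in> rational_at_0"
    unfolding rational_at_0_iff by (intro exI[of _ 0] exI[of _ 1]) simp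
next
  fix f g assume "f \<in> rational_at_0" "g \<in> rational_at_0"
  then obtain p q p' q' :: "complex poly" where
    *: "poly q 0 \<noteq> 0" "f * fps_of_poly q = fps_of_poly p"
       "poly q' 0 \<noteq> 0" "g * fps_of_poly q' = fps_of_poly p'"
    unfolding rational_at_0_iff by blast
  have "(f + g) * fps_of_poly (q * q') = fps_of_poly (p * q' + p' * q)"
    by (simp add: fps_of_poly_mult fps_of_poly_add algebra_simps flip: *(2,4))
  thus "f + g \<in> rational_at_0"
    unfolding rational_at_0_iff using *(1,3) by (intro exI[of _ "p * q' + p' * q"] exI[of _ "q * q'"]) auto
next
  fix c f assume "f \<in> rational_at_0"
  then obtain p q :: "complex poly" where
    *: "poly q 0 \<noteq> 0" "f * fps_of_poly q = fps_of_poly p"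
    unfolding rational_at_0_iff by blast
  have "(fps_const c * f) * fps_of_poly q = fps_of_poly (Polynomial.smult c p)"
    by (simp add: fps_of_poly_smult mult.assoc *(2))
  thus "fps_const c * f \<in> rational_at_0"
    unfolding rational_at_0_iff using *(1) by blast
qed

text \<open>The library dimension of a set is that of its linear span, so this justifies applying
  it to the eigenspaces. It is \<open>0\<close> for an infinite-dimensional space, so a positive value
  entails finite dimension.\<close>

lemma subspace_eigenspace: "fps_space.subspace (eigenspace n \<omega> L \<kappa>)"
  unfolding fps_space.subspace_def
proof (intro conjI ballI allI)
  show "0 \<in> eigenspace n \<omega> L \<kappa>"
    unfolding eigenspace_def quasi_periodic_def U_def
    using fps_space.subspace_0[OF subspace_rational_at_0]
    by (auto simp: fps_eq_iff intro!: exI[of _ "\<lambda>_. 0"])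
next
  fix f g assume fg: "f \<in> eigenspace n \<omega> L \<kappa>" "g \<in> eigenspace n \<omega> L \<kappa>"
  then obtain a b where
    "f = Abs_fps (\<lambda>k. of_nat k ^ (\<kappa> - 1) * a k)" "\<forall>k. a (k + L) = a k"
    "g = Abs_fps (\<lambda>k. of_nat k ^ (\<kappa> - 1) * b k)" "\<forall>k. b (k + L) = b k"
    unfolding eigenspace_def quasi_periodic_def by blast
  hence "\<exists>a. f + g = Abs_fps (\<lambda>k. of_nat k ^ (\<kappa> - 1) * a k) \<and> (\<forall>k. a (k + L) = a k)"
    by (intro exI[of _ "\<lambda>k. a k + b k"]) (simp add: fps_eq_iff distrib_left)
  moreover have "U n (f + g) = U n f + U n g"
    by (simp add: U_def fps_eq_iff)
  ultimately show "f + g \<in> eigenspace n \<omega> L \<kappa>"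
    using fg fps_space.subspace_add[OF subspace_rational_at_0]
    by (simp add: eigenspace_def quasi_periodic_def distrib_left)
next
  fix c f assume f: "f \<in> eigenspace n \<omega> L \<kappa>"
  then obtain a where
    "f = Abs_fps (\<lambda>k. of_nat k ^ (\<kappa> - 1) * a k)" "\<forall>k. a (k + L) = a k"
    unfolding eigenspace_def quasi_periodic_def by blast
  hence "\<exists>a. fps_const c * f = Abs_fps (\<lambda>k. of_nat k ^ (\<kappa> - 1) * a k) \<and> (\<forall>k. a (k + L) = a k)"
    by (intro exI[of _ "\<lambda>k. c * a k"]) (simp add: fps_eq_iff)
  moreover have "U n (fps_const c * f) = fps_const c * U n f"
    by (simp add: U_def fps_eq_iff)
  ultimately show "fps_const c * f \<in> eigenspace n \<omega> L \<kappa>"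
    using f fps_space.subspace_scale[OF subspace_rational_at_0]
    by (simp add: eigenspace_def quasi_periodic_def mult.left_commute)
qed

section \<open>Arithmetic notions\<close>

definition coprime_part :: "nat \<Rightarrow> nat \<Rightarrow> nat" where
  "coprime_part L n = Max {d. d dvd L \<and> coprime d n}"

definition primitive_root_of_unity :: "nat \<Rightarrow> complex \<Rightarrow> bool" where
  "primitive_root_of_unity m \<omega> \<longleftrightarrow>
     m > 0 \<and> \<omega> ^ m = 1 \<and> (\<forall>k. 0 < k \<and> k < m \<longrightarrow> \<omega> ^ k \<noteq> 1)"

definition moebius :: "nat \<Rightarrow> int" where
  "moebius n = (if squarefree n then (-1) ^ card (prime_factors n) else 0)"

section \<open>The Zolotarev graph\<close>

text \<open>Residue classes modulo \<open>L\<close> are represented by their least nonnegative representatives.\<close>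

definition zolotarev_graph :: "nat \<Rightarrow> nat \<Rightarrow> nat pair_pre_digraph" where
  "zolotarev_graph n L =
     \<lparr> pverts = {0..<L},
       parcs = {(a, b). a \<in> {0..<L} \<and> b \<in> {0..<L} \<and> [n * a = b] (mod L)} \<rparr>"

definition zolotarev_cycles :: "nat \<Rightarrow> nat \<Rightarrow> nat \<Rightarrow> nat set set" where
  "zolotarev_cycles n L j =
     {C. j > 0 \<and> (\<exists>r \<in> pverts (zolotarev_graph n L).
        C = (\<lambda>i. n ^ i * r mod L) ` {0..<j} \<and> card C = j \<and> [n ^ j * r = r] (mod L))}"

text \<open>These sets are exactly the vertex sets of the cycles of the graph in the sense of the
  graph library, where a loop is a cycle of length 1.\<close>

lemma pcas_map_upt:
  "a \<le> b \<Longrightarrow> pcas (f a) (map (\<lambda>i. (f i, f (Suc i))) [a..<b]) (f b)"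
  "a \<le> b \<Longrightarrow> pawalk_verts (f a) (map (\<lambda>i. (f i, f (Suc i))) [a..<b]) = map f [a..<Suc b]"
  by (induction a rule: inc_induct) (auto simp: upt_conv_Cons)

lemma zolotarev_walk:
  assumes "pcas u p v" "set p \<subseteq> parcs (zolotarev_graph n L)" "u < L"
  shows "p = map (\<lambda>i. (n ^ i * u mod L, n ^ Suc i * u mod L)) [0..<length p] \<and>
         v = n ^ length p * u mod L"
  using assms
proof (induction p arbitrary: u)
  case (Cons e p)
  obtain w where e: "e = (u, w)"
    using Cons.prems(1) by (cases e) auto
  have w: "w = n * u mod L" "w < L"
    using Cons.prems(2) e by (auto simp: zolotarev_graph_def cong_def)
  have *: "n ^ i * w mod L = n ^ Suc i * u mod L" for i
    unfolding w(1) by (simp add: mod_simps ac_simps)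
  have "p = map (\<lambda>i. (n ^ i * w mod L, n ^ Suc i * w mod L)) [0..<length p] \<and>
         v = n ^ length p * w mod L"
    using Cons.prems e w by (intro Cons.IH) auto
  hence p: "p = map (\<lambda>i. (n ^ Suc i * u mod L, n ^ Suc (Suc i) * u mod L)) [0..<length p]"
    and v: "v = n ^ Suc (length p) * u mod L"
    unfolding * by blast+
  have "e = (n ^ 0 * u mod L, n ^ Suc 0 * u mod L)"
    using e w Cons.prems(3) by simp
  moreover have "[0..<length (e # p)] = 0 # map Suc [0..<length p]"
    by (simp add: map_Suc_upt upt_conv_Cons del: upt_Suc)
  ultimately show ?case
    using p v by (simp only: list.map map_map o_def length_Cons)
qed auto

lemma zolotarev_cycles_conv_cycle:
  "C \<in> zolotarev_cycles n L j \<longleftrightarrow>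
     (\<exists>p. pre_digraph.cycle (with_proj (zolotarev_graph n L)) p \<and> length p = j \<and> C = fst ` set p)"
  (is "?lhs \<longleftrightarrow> ?rhs")
proof
  assume ?lhs
  then obtain r where j: "j > 0" and r: "r < L" and C: "C = (\<lambda>i. n ^ i * r mod L) ` {0..<j}"
    and card: "card C = j" and cong: "[n ^ j * r = r] (mod L)"
    unfolding zolotarev_cycles_def by (auto simp: zolotarev_graph_def)
  define f where "f = (\<lambda>i. n ^ i * r mod L)"
  define p where "p = map (\<lambda>i. (f i, f (Suc i))) [0..<j]"
  have f0: "f 0 = r" "f j = r"
    using r cong by (auto simp: f_def cong_def)
  have inj: "inj_on f {0..<j}"
    using C card by (intro eq_card_imp_inj_on) (auto simp: f_def)
  have arcs: "set p \<subseteq> parcs (zolotarev_graph n L)"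
    using r by (auto simp: p_def f_def zolotarev_graph_def cong_def mod_simps ac_simps)
  have verts: "pawalk_verts r p = map f [0..<Suc j]"
    using pcas_map_upt(2)[of 0 j f] f0 by (simp add: p_def)
  have "map f [1..<Suc j] = map f [1..<j] @ [f 0]"
    using j f0 by simp
  moreover have "distinct (map f [1..<j] @ [f 0])"
    using inj j by (force simp: distinct_map inj_on_def)
  ultimately have "distinct (tl (pawalk_verts r p))"
    unfolding verts by (simp add: upt_conv_Cons del: upt_Suc)
  moreover have "pcas r p r"
    using pcas_map_upt(1)[of 0 j f] f0 by (simp add: p_def)
  ultimately have "pre_digraph.cycle (with_proj (zolotarev_graph n L)) p"
    unfolding pre_digraph.cycle_def pre_digraph.awalk_def
    using arcs r j by (intro exI[of _ r])
      (auto simp: cas_with_proj_eq awalk_verts_with_proj_eq p_def zolotarev_graph_def)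
  moreover have "C = fst ` set p"
    unfolding C p_def f_def by force
  ultimately show ?rhs
    by (intro exI[of _ p]) (simp add: p_def)
next
  assume ?rhs
  then obtain p u where len: "length p = j" and C: "C = fst ` set p" and "p \<noteq> []"
    and u: "u < L" and arcs: "set p \<subseteq> parcs (zolotarev_graph n L)"
    and cas: "pcas u p u" and dist: "distinct (tl (pawalk_verts u p))"
    unfolding pre_digraph.cycle_def pre_digraph.awalk_def
    by (auto simp: cas_with_proj_eq awalk_verts_with_proj_eq zolotarev_graph_def)
  define f where "f = (\<lambda>i. n ^ i * u mod L)"
  have j: "j > 0"
    using len \<open>p \<noteq> []\<close> by auto
  have p: "p = map (\<lambda>i. (f i, f (Suc i))) [0..<j]" and fj: "f j = u"
    using zolotarev_walk[OF cas arcs u] len by (auto simp: f_def)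
  have f0: "f 0 = u"
    using u by (simp add: f_def)
  have "pawalk_verts u p = map f [0..<Suc j]"
    using pcas_map_upt(2)[of 0 j f] f0 p by simp
  hence "distinct (map f [1..<Suc j])"
    using dist by (simp add: upt_conv_Cons del: upt_Suc)
  hence "card (f ` {1..<Suc j}) = j"
    by (simp add: distinct_map card_image del: upt_Suc)
  moreover have "f ` {1..<Suc j} = insert (f j) (f ` {1..<j})"
    using j by (simp add: atLeastLessThanSuc)
  moreover have "f ` {0..<j} = insert (f 0) (f ` {1..<j})"
    using j by (metis One_nat_def image_insert set_upt upt_conv_Cons list.simps(15))
  ultimately have "card (f ` {0..<j}) = j"
    using f0 fj by simp
  moreover have "C = f ` {0..<j}"
    unfolding C by (subst p) force
  moreover have "[n ^ j * u = u] (mod L)"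
    using fj u by (simp add: f_def cong_def)
  ultimately show ?lhs
    unfolding zolotarev_cycles_def using u j by (auto simp: f_def zolotarev_graph_def)
qed

end

theory Submission
  imports Defs
begin

text \<open>
  Write \<open>f = (\<Sum>k. k ^ (\<kappa> - 1) * a k * x ^ k)\<close> with \<open>a\<close> periodic modulo \<open>L\<close>. In the equation
  \<open>U n f = n ^ (\<kappa> - 1) * \<omega> * f\<close> the factors \<open>(n * k) ^ (\<kappa> - 1)\<close> cancel, and every periodic \<open>a\<close>
  gives a rational function. So the eigenspace is the space of all functions \<open>a\<close> on the residues
  modulo \<open>L\<close> with \<open>a (n * k) = \<omega> * a k\<close> (\<open>eigenspace_eq_image\<close>): following an edge of the Zolotarev
  graph multiplies the value of \<open>a\<close> by \<open>\<omega>\<close>. Every walk in the graph runs into a cycle, and \<open>\<omega> \<noteq> 0\<close>, so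
  the values on the cycles determine \<open>a\<close>. On a cycle, one value determines the others. Once round a
  cycle of length \<open>j\<close> the value is multiplied by \<open>\<omega> ^ j\<close>; it must therefore vanish unless \<open>m\<close> divides
  \<open>j\<close>, and if \<open>m\<close> divides \<open>j\<close> it can be prescribed. Hence the dimension is the number of cycles whose
  length is a multiple of \<open>m\<close> (\<open>dim_eigenspace\<close>).

  The cycles are governed by an order: \<open>n ^ j\<close> fixes the residue \<open>r\<close> if and only if \<open>n ^ j\<close> is \<open>1\<close>
  modulo \<open>L div gcd r L\<close> (\<open>power_fixes_iff_period_dvd\<close>). So \<open>r\<close> lies on a cycle if and only if this
  divisor of \<open>L\<close> is coprime to \<open>n\<close>. It then divides the part of \<open>L\<close> coprime to \<open>n\<close>, and the length of
  the cycle divides \<open>c\<close> (\<open>period_dvd_ord_coprime_part\<close>), which bounds the range of the sum.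

  For the number of cycles of a given length, count the residues fixed by \<open>n ^ d\<close> in two ways. They
  are the solutions of a linear congruence, of which there are \<open>gcd (n ^ d - 1) L\<close>, and they are the
  residues on the cycles whose length divides \<open>d\<close> (\<open>gcd_eq_sum_card_cycles\<close>). Moebius inversion isolates
  the cycles of length \<open>j\<close>.
\<close>

section \<open>Moebius inversion\<close>

lemma moebius_prime_mult:
  assumes "prime p" "\<not> p dvd d" "squarefree d"
  shows "moebius (p * d) = - moebius d"
proof -
  have cop: "coprime p d"
    using assms prime_imp_coprime by blast
  have nz: "d \<noteq> 0"
    using assms by (intro notI) simp
  have "squarefree (p * d)"
    using assms cop squarefree_prime by (blast intro: squarefree_mult_coprime)
  moreover have "prime_factors (p * d) = insert p (prime_factors d)"
    using assms nz by (subst prime_factors_product) (auto simp: prime_factorization_prime)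
  moreover have "p \<notin> prime_factors d"
    using assms by (auto dest: in_prime_factors_imp_dvd)
  ultimately show ?thesis
    using assms by (simp add: moebius_def)
qed

text \<open>For a prime \<open>p\<close> dividing \<open>n\<close>, the map \<open>d \<mapsto> p * d\<close> pairs the squarefree divisors of \<open>n\<close> that
  are prime to \<open>p\<close> with those that are divisible by \<open>p\<close>, and the two terms of a pair cancel.\<close>

lemma sum_moebius_divisors:
  assumes "n > 0"
  shows "(\<Sum>d | d dvd n. moebius d) = (if n = 1 then 1 else 0)"
proof (cases "n = 1")
  case True
  have "{d::nat. d dvd 1} = {1}" by auto
  then show ?thesis using True by (simp add: moebius_def)
next
  case False
  then obtain p where p: "prime p" "p dvd n"
    using prime_factor_nat by blast
  define A where "A = {d. d dvd n \<and> squarefree d \<and> \<not> p dvd d}"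
  have fin: "finite {d. d dvd n}"
    using assms by simp
  have finA: "finite A"
    by (rule finite_subset[OF _ fin]) (auto simp: A_def)
  have p0: "p > 0" using p prime_gt_0_nat by blast
  have split: "{d. d dvd n \<and> squarefree d} = A \<union> (*) p ` A"
  proof (intro equalityI subsetI)
    fix d assume d: "d \<in> {d. d dvd n \<and> squarefree d}"
    show "d \<in> A \<union> (*) p ` A"
    proof (cases "p dvd d")
      case True
      then obtain e where e: "d = p * e" by blast
      have "\<not> p dvd e"
      proof
        assume "p dvd e"
        then have "p ^ 2 dvd d" by (simp add: e power2_eq_square)
        with d have "p dvd 1" using squarefreeD[of d p] by blast
        with p show False by (simp add: prime_nat_iff)
      qed
      moreover have "e dvd n" using d e by (auto intro: dvd_trans)
      moreover have "squarefree e" using d e squarefree_mono[of e d] by auto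
      ultimately show ?thesis using e by (auto simp: A_def)
    qed (use d in \<open>auto simp: A_def\<close>)
  next
    fix d assume "d \<in> A \<union> (*) p ` A"
    then consider "d \<in> A" | e where "e \<in> A" "d = p * e" by blast
    then show "d \<in> {d. d dvd n \<and> squarefree d}"
    proof cases
      case 2
      have cop: "coprime p e"
        using 2 p prime_imp_coprime by (auto simp: A_def)
      then show ?thesis
        using 2 p by (auto simp: A_def intro: divides_mult squarefree_mult_coprime squarefree_prime)
    qed (auto simp: A_def)
  qed
  have "(\<Sum>d | d dvd n. moebius d) = (\<Sum>d | d dvd n \<and> squarefree d. moebius d)"
    using fin by (intro sum.mono_neutral_right) (auto simp: moebius_def)
  also have "\<dots> = sum moebius A + sum moebius ((*) p ` A)"
    unfolding split using finA by (intro sum.union_disjoint) (auto simp: A_def)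
  also have "sum moebius ((*) p ` A) = (\<Sum>d\<in>A. moebius (p * d))"
    using p0 by (subst sum.reindex) (auto simp: inj_on_def)
  also have "\<dots> = - sum moebius A"
    using p by (simp add: A_def moebius_prime_mult sum_negf[symmetric])
  finally show ?thesis using False by simp
qed

text \<open>After exchanging the sums, \<open>F e\<close> is multiplied by the sum of \<open>moebius (j div d)\<close> over all \<open>d\<close>
  between \<open>e\<close> and \<open>j\<close> in the divisibility order. There \<open>j div d\<close> runs through the divisors of
  \<open>j div e\<close>, so that only \<open>e = j\<close> survives.\<close>

theorem moebius_inversion:
  fixes F G :: "nat \<Rightarrow> 'a::comm_ring_1"
  assumes "j > 0" and G: "\<And>d. d dvd j \<Longrightarrow> G d = (\<Sum>e | e dvd d. F e)"
  shows "(\<Sum>d | d dvd j. of_int (moebius (j div d)) * G d) = F j"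
proof -
  have fin: "finite {d. d dvd j}" using assms by simp
  have inner: "(\<Sum>d \<in> {d \<in> {d. d dvd j}. e dvd d}. moebius (j div d)) = (if j = e then 1 else 0)"
    if e: "e dvd j" for e
  proof -
    have pos: "j div e > 0" "e > 0"
      using e assms by (auto simp: dvd_div_eq_0_iff dvd_pos_nat)
    have "(\<Sum>d \<in> {d \<in> {d. d dvd j}. e dvd d}. moebius (j div d)) = (\<Sum>k | k dvd j div e. moebius k)"
    proof (rule sum.reindex_bij_witness[of _ "\<lambda>k. j div k" "\<lambda>d. j div d"])
      fix d assume "d \<in> {d \<in> {d. d dvd j}. e dvd d}"
      then obtain u v where "j = d * u" "d = e * v" by (auto elim!: dvdE)
      with assms show "j div (j div d) = d" "j div d \<in> {k. k dvd j div e}"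
        by auto
    next
      fix k assume "k \<in> {k. k dvd j div e}"
      then obtain u where "j div e = k * u" by (auto elim!: dvdE)
      with e have "j = e * k * u" by (metis dvd_mult_div_cancel mult.assoc)
      with assms show "j div (j div k) = k" "j div k \<in> {d \<in> {d. d dvd j}. e dvd d}"
        by auto
    qed auto
    also have "\<dots> = (if j = e then 1 else 0)"
      using pos e by (subst sum_moebius_divisors) auto
    finally show ?thesis .
  qed
  have "(\<Sum>d | d dvd j. of_int (moebius (j div d)) * G d)
      = (\<Sum>d | d dvd j. \<Sum>e | e \<in> {e. e dvd j} \<and> e dvd d. of_int (moebius (j div d)) * F e)"
  proof (rule sum.cong[OF refl])
    fix d assume d: "d \<in> {d. d dvd j}"
    then have "{e. e \<in> {e. e dvd j} \<and> e dvd d} = {e. e dvd d}"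
      by (auto intro: dvd_trans)
    then show "of_int (moebius (j div d)) * G d
        = (\<Sum>e | e \<in> {e. e dvd j} \<and> e dvd d. of_int (moebius (j div d)) * F e)"
      using d G by (simp add: sum_distrib_left)
  qed
  also have "\<dots> = (\<Sum>e | e dvd j. \<Sum>d | d \<in> {d. d dvd j} \<and> e dvd d. of_int (moebius (j div d)) * F e)"
    using fin fin by (rule sum.swap_restrict)
  also have "\<dots> = (\<Sum>e | e dvd j. (if e = j then 1 else 0) * F e)"
  proof (rule sum.cong[OF refl])
    fix e assume "e \<in> {e. e dvd j}"
    then have "(of_int (\<Sum>d \<in> {d \<in> {d. d dvd j}. e dvd d}. moebius (j div d)) :: 'a)
        = (if e = j then 1 else 0)"
      by (subst inner) auto
    then show "(\<Sum>d | d \<in> {d. d dvd j} \<and> e dvd d. of_int (moebius (j div d)) * F e)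
        = (if e = j then 1 else 0) * F e"
      by (simp add: sum_distrib_right[symmetric])
  qed
  also have "\<dots> = F j"
    using fin by (simp add: if_distrib[of "\<lambda>x. x * _"] sum.delta cong: if_cong)
  finally show ?thesis .
qed


section \<open>Cyclic residues and their periods\<close>

text \<open>The order that governs the powers of \<open>n\<close> fixing \<open>r\<close>. An order is \<open>0\<close> by convention when \<open>n\<close> is not
  coprime to the modulus; this happens exactly for the residues that lie on no cycle, and is the right
  value for them since \<open>0\<close> divides only the exponent \<open>0\<close>.\<close>

definition period :: "nat \<Rightarrow> nat \<Rightarrow> nat \<Rightarrow> nat" where
  "period n L r = ord (L div gcd r L) n"

definition orbit :: "nat \<Rightarrow> nat \<Rightarrow> nat \<Rightarrow> nat set" where
  "orbit n L r = (\<lambda>i. n ^ i * r mod L) ` {0..<period n L r}"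

lemma dvd_mult_iff_div_gcd_dvd:
  fixes L x r :: nat
  assumes "L > 0"
  shows "L dvd x * r \<longleftrightarrow> L div gcd r L dvd x"
proof -
  define g where "g = gcd r L"
  obtain r' L' where r': "r = g * r'" and L': "L = g * L'"
    unfolding g_def by (meson dvdE gcd_dvd1 gcd_dvd2)
  have g: "g > 0" using assms by (simp add: g_def)
  have "coprime (r div gcd r L) (L div gcd r L)"
    using assms by (intro div_gcd_coprime) auto
  moreover have "r div g = r'" "L div g = L'"
    using g by (simp_all add: r' L')
  ultimately have "coprime r' L'" by (simp flip: g_def)
  have div_g: "L div gcd r L = L'"
    using \<open>L div g = L'\<close> by (simp add: g_def)
  from \<open>coprime r' L'\<close> have "L' dvd x * r' \<longleftrightarrow> L' dvd x"
    by (intro coprime_dvd_mult_left_iff) (simp add: coprime_commute)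
  moreover have "L dvd x * r \<longleftrightarrow> L' dvd x * r'"
  proof -
    have "x * r = g * (x * r')" by (simp add: r')
    moreover have "g * L' dvd g * (x * r') \<longleftrightarrow> L' dvd x * r'"
      using g by simp
    ultimately show ?thesis by (simp only: L')
  qed
  ultimately show ?thesis by (simp add: div_g)
qed

lemma cong_mult_right_iff_div_gcd:
  fixes a b r L :: nat
  assumes "L > 0"
  shows "[a * r = b * r] (mod L) \<longleftrightarrow> [a = b] (mod L div gcd r L)"
proof -
  have "nat \<bar>int (a * r) - int (b * r)\<bar> = nat \<bar>int a - int b\<bar> * r"
    by (simp add: left_diff_distrib[symmetric] abs_mult nat_mult_distrib)
  then show ?thesis
    by (simp only: cong_altdef_nat' dvd_mult_iff_div_gcd_dvd[OF assms])
qed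

lemma power_fixes_iff_period_dvd:
  assumes "L > 0"
  shows "[n ^ j * r = r] (mod L) \<longleftrightarrow> period n L r dvd j"
  using cong_mult_right_iff_div_gcd[OF assms, of "n ^ j" r 1]
  by (simp add: period_def ord_divides')

lemma power_mult_cong_iff:
  assumes "L > 0" "period n L r > 0"
  shows "[n ^ i * r = n ^ k * r] (mod L) \<longleftrightarrow> [i = k] (mod period n L r)"
  using assms by (simp add: cong_mult_right_iff_div_gcd period_def order_divides_expdiff)

lemma eq_of_same_multiples:
  assumes "\<And>j. a dvd j \<longleftrightarrow> b dvd j"
  shows "a = (b::nat)"
  using assms by (meson dvd_antisym dvd_refl)

text \<open>Moving along a cycle does not change which powers of \<open>n\<close> fix a residue, because on the cycle
  multiplication by \<open>n ^ i\<close> can be cancelled.\<close>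

lemma period_power_mult:
  assumes "L > 0" "period n L r > 0" "[y = n ^ i * r] (mod L)"
  shows "period n L y = period n L r"
proof (rule eq_of_same_multiples)
  fix j
  have "[n ^ j * y = y] (mod L) \<longleftrightarrow> [n ^ j * (n ^ i * r) = n ^ i * r] (mod L)"
    using assms(3) by (meson cong_scalar_left cong_sym cong_trans)
  also have "\<dots> \<longleftrightarrow> [n ^ (j + i) * r = n ^ i * r] (mod L)"
    by (simp add: power_add mult.assoc)
  also have "\<dots> \<longleftrightarrow> [j + i = 0 + i] (mod period n L r)"
    using assms by (simp add: power_mult_cong_iff)
  also have "\<dots> \<longleftrightarrow> period n L r dvd j"
    by (subst cong_add_rcancel_nat) (simp add: cong_0_iff)
  finally show "period n L y dvd j \<longleftrightarrow> period n L r dvd j"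
    using assms by (simp add: power_fixes_iff_period_dvd)
qed

text \<open>Two of the first \<open>L + 1\<close> iterates of \<open>k\<close> agree modulo \<open>L\<close>, and the earlier one of them lies on a
  cycle.\<close>

lemma eventually_cyclic:
  assumes "L > 0"
  shows "\<exists>t. period n L (n ^ t * k) > 0"
proof -
  have "\<not> inj_on (\<lambda>i. n ^ i * k mod L) {..L}"
  proof
    assume "inj_on (\<lambda>i. n ^ i * k mod L) {..L}"
    moreover have "(\<lambda>i. n ^ i * k mod L) ` {..L} \<subseteq> {..<L}"
      using assms by auto
    ultimately have "card {..L} \<le> card {..<L}"
      by (intro card_inj_on_le) auto
    then show False by simp
  qed
  then obtain i j where "i < j" "n ^ i * k mod L = n ^ j * k mod L"
    by (metis (no_types, lifting) inj_onI linorder_neqE_nat)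
  then have "[n ^ (j - i) * (n ^ i * k) = n ^ i * k] (mod L)"
    by (simp add: cong_def power_add[symmetric] flip: mult.assoc)
  then have "period n L (n ^ i * k) dvd j - i"
    using assms by (simp add: power_fixes_iff_period_dvd)
  then show ?thesis using \<open>i < j\<close> by (intro exI[of _ i]) (auto intro!: Nat.gr0I)
qed

lemma mem_orbit_iff:
  assumes "L > 0" "period n L r > 0"
  shows "y \<in> orbit n L r \<longleftrightarrow> y < L \<and> (\<exists>i. [y = n ^ i * r] (mod L))"
proof safe
  fix i assume "y < L" "[y = n ^ i * r] (mod L)"
  moreover have "[n ^ i * r = n ^ (i mod period n L r) * r] (mod L)"
    using assms by (simp add: power_mult_cong_iff)
  ultimately have "y = n ^ (i mod period n L r) * r mod L"
    by (simp add: cong_def)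
  then show "y \<in> orbit n L r"
    using assms by (auto simp: orbit_def)
qed (use assms in \<open>auto simp: orbit_def cong_def\<close>)

lemma orbit_eq_of_mem:
  assumes "L > 0" "period n L r > 0" "y \<in> orbit n L r"
  shows "orbit n L y = orbit n L r"
proof -
  obtain i where i: "[y = n ^ i * r] (mod L)"
    using assms mem_orbit_iff by blast
  define p where "p = period n L r"
  have per: "period n L y = p"
    using period_power_mult[OF assms(1,2) i] by (simp add: p_def)
  \<comment> \<open>Going round the cycle \<open>i\<close> times is \<open>p * i\<close> steps, of which the first \<open>i\<close> lead from \<open>r\<close> to \<open>y\<close>.\<close>
  have inverse_step: "[r = n ^ (p * i - i) * y] (mod L)"
  proof -
    have le: "i \<le> p * i" using assms by (simp add: p_def)
    have "[n ^ (p * i - i) * y = n ^ (p * i - i) * (n ^ i * r)] (mod L)"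
      using i by (rule cong_scalar_left)
    also have "n ^ (p * i - i) * (n ^ i * r) = n ^ (p * i) * r"
      using le by (simp add: power_add[symmetric] flip: mult.assoc)
    also have "[n ^ (p * i) * r = r] (mod L)"
      using assms by (simp add: power_fixes_iff_period_dvd p_def)
    finally show ?thesis by (rule cong_sym)
  qed
  have step: "[z = n ^ (a + b) * v] (mod L)" if "[z = n ^ a * u] (mod L)" "[u = n ^ b * v] (mod L)"
    for z u v a b
    using cong_trans[OF that(1) cong_scalar_left[OF that(2), of "n ^ a"]]
    by (simp add: power_add mult.assoc)
  have "(\<exists>a. [z = n ^ a * y] (mod L)) \<longleftrightarrow> (\<exists>a. [z = n ^ a * r] (mod L))" for z
    using step[OF _ i] step[OF _ inverse_step] by blast
  then show ?thesis
    using assms per by (simp add: set_eq_iff mem_orbit_iff p_def)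
qed

lemma self_mem_orbit:
  assumes "r < L" "period n L r > 0"
  shows "r \<in> orbit n L r"
  using assms by (subst mem_orbit_iff) (auto intro: exI[of _ 0])

lemma card_orbit:
  assumes "L > 0"
  shows "card (orbit n L r) = period n L r"
proof -
  have "inj_on (\<lambda>i. n ^ i * r mod L) {0..<period n L r}"
  proof (rule inj_onI)
    fix i k assume ik: "i \<in> {0..<period n L r}" "k \<in> {0..<period n L r}"
      and "n ^ i * r mod L = n ^ k * r mod L"
    then have "[i = k] (mod period n L r)"
      using assms power_mult_cong_iff[of L n r i k] by (simp add: cong_def)
    with ik show "i = k" by (simp add: cong_def)
  qed
  then show ?thesis by (simp add: orbit_def card_image)
qed


section \<open>Counting the cycles\<close>

text \<open>If the first \<open>j\<close> iterates of \<open>r\<close> are distinct and \<open>n ^ j\<close> fixes \<open>r\<close>, then \<open>j\<close> is the period: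
  the period divides \<open>j\<close>, and \<open>r\<close> has no more distinct iterates than its period.\<close>

lemma zolotarev_cycles_eq_orbits:
  assumes "L > 0" "j > 0"
  shows "zolotarev_cycles n L j = orbit n L ` {r. r < L \<and> period n L r = j}"
proof (intro equalityI subsetI)
  fix C assume "C \<in> zolotarev_cycles n L j"
  then obtain r where r: "r < L" and C: "C = (\<lambda>i. n ^ i * r mod L) ` {0..<j}"
    and card: "card C = j" and fix_r: "[n ^ j * r = r] (mod L)"
    by (auto simp: zolotarev_cycles_def zolotarev_graph_def)
  have dvd: "period n L r dvd j"
    using fix_r assms by (simp add: power_fixes_iff_period_dvd)
  then have pos: "period n L r > 0" using assms by (auto intro!: Nat.gr0I)
  have "C \<subseteq> orbit n L r"
    using assms r by (auto simp: C mem_orbit_iff[OF _ pos] cong_def)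
  then have "j \<le> period n L r"
    using card card_mono[of "orbit n L r" C] card_orbit[OF assms(1), of n r] by (auto simp: orbit_def)
  then have "period n L r = j"
    using dvd assms by (simp add: dvd_imp_le le_antisym)
  then show "C \<in> orbit n L ` {r. r < L \<and> period n L r = j}"
    using r by (auto simp: C orbit_def)
next
  fix C assume "C \<in> orbit n L ` {r. r < L \<and> period n L r = j}"
  then obtain r where r: "r < L" "period n L r = j" "C = orbit n L r" by blast
  have "[n ^ j * r = r] (mod L)" "card C = j"
    using assms r by (simp_all add: power_fixes_iff_period_dvd card_orbit)
  then show "C \<in> zolotarev_cycles n L j"
    using assms r by (auto simp: zolotarev_cycles_def zolotarev_graph_def orbit_def)
qed

lemma zolotarev_cycle_eq_orbit:
  assumes "L > 0" "j > 0" "C \<in> zolotarev_cycles n L j" "x \<in> C"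
  shows "x < L" "period n L x = j" "C = orbit n L x"
proof -
  obtain r where r: "r < L" "period n L r = j" "C = orbit n L r"
    using assms zolotarev_cycles_eq_orbits by blast
  have pos: "period n L r > 0" using r assms by simp
  have x: "x \<in> orbit n L r" using assms r by simp
  then show "x < L" "C = orbit n L x"
    using r mem_orbit_iff[OF assms(1) pos] orbit_eq_of_mem[OF assms(1) pos x] by simp_all
  show "period n L x = j"
    using x r mem_orbit_iff[OF assms(1) pos] period_power_mult[OF assms(1) pos] by blast
qed

lemma finite_zolotarev_cycles:
  assumes "L > 0" "j > 0"
  shows "finite (zolotarev_cycles n L j)"
  using assms by (simp add: zolotarev_cycles_eq_orbits)

text \<open>The cycles of length \<open>j\<close> partition the residues of period \<open>j\<close> into blocks of size \<open>j\<close>.\<close>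

lemma card_period_eq:
  assumes "L > 0" "j > 0"
  shows "card {r. r < L \<and> period n L r = j} = j * card (zolotarev_cycles n L j)"
proof -
  have "\<Union>(zolotarev_cycles n L j) = {r. r < L \<and> period n L r = j}"
  proof (intro equalityI subsetI)
    fix r assume "r \<in> {r. r < L \<and> period n L r = j}"
    then show "r \<in> \<Union>(zolotarev_cycles n L j)"
      using assms self_mem_orbit[of r L n] by (auto simp: zolotarev_cycles_eq_orbits)
  qed (use zolotarev_cycle_eq_orbit[OF assms] in blast)
  moreover have "j * card (zolotarev_cycles n L j) = card (\<Union>(zolotarev_cycles n L j))"
  proof (rule card_partition)
    show "finite (zolotarev_cycles n L j)" by (rule finite_zolotarev_cycles[OF assms])
    show "finite (\<Union>(zolotarev_cycles n L j))" using calculation by simp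
    show "card C = j" if "C \<in> zolotarev_cycles n L j" for C
      using that by (auto simp: zolotarev_cycles_def)
    show "C \<inter> D = {}"
      if "C \<in> zolotarev_cycles n L j" "D \<in> zolotarev_cycles n L j" "C \<noteq> D" for C D
      using that zolotarev_cycle_eq_orbit(3)[OF assms] by blast
  qed
  ultimately show ?thesis by simp
qed

lemma card_multiples_below:
  fixes N L :: nat
  assumes "L > 0"
  shows "card {r. r < L \<and> L dvd N * r} = gcd N L"
proof -
  define g L' where "g = gcd N L" and "L' = L div gcd N L"
  have L: "L = g * L'"
    unfolding g_def L'_def by (rule dvd_mult_div_cancel[symmetric]) (rule gcd_dvd2)
  then have L': "L' > 0" using assms by (cases "L' = 0") auto
  have "L dvd N * r \<longleftrightarrow> L' dvd r" for r
    using dvd_mult_iff_div_gcd_dvd[OF assms, of r N] by (simp add: L'_def mult.commute)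
  then have "{r. r < L \<and> L dvd N * r} = {r. r < g * L' \<and> L' dvd r}"
    using L by simp
  also have "\<dots> = (\<lambda>i. i * L') ` {..<g}"
  proof (intro equalityI subsetI)
    fix r assume "r \<in> {r. r < g * L' \<and> L' dvd r}"
    then obtain i where i: "r = i * L'" "i * L' < g * L'" by (auto elim!: dvdE simp: mult.commute)
    then show "r \<in> (\<lambda>i. i * L') ` {..<g}" by auto
  qed (use L' in auto)
  also have "card \<dots> = g"
    using L' by (simp add: card_image inj_on_def)
  finally show ?thesis by (simp add: g_def)
qed

text \<open>Both sides count the residues fixed by \<open>n ^ d\<close>: on the left as the solutions \<open>r\<close> of
  \<open>(n ^ d - 1) * r \<equiv> 0\<close>, on the right sorted by their period.\<close>

lemma gcd_eq_sum_card_cycles: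
  assumes "n > 0" "L > 0" "d > 0"
  shows "gcd (n ^ d - 1) L = (\<Sum>e | e dvd d. e * card (zolotarev_cycles n L e))"
proof -
  have "L dvd (n ^ d - 1) * r \<longleftrightarrow> period n L r dvd d" for r
  proof -
    have "r \<le> n ^ d * r" using assms by simp
    then have "[n ^ d * r = r] (mod L) \<longleftrightarrow> L dvd (n ^ d - 1) * r"
      by (simp add: cong_altdef_nat diff_mult_distrib)
    then show ?thesis using assms by (simp add: power_fixes_iff_period_dvd)
  qed
  then have "gcd (n ^ d - 1) L = card {r. r < L \<and> period n L r dvd d}"
    using card_multiples_below[of L "n ^ d - 1"] assms by simp
  also have "{r. r < L \<and> period n L r dvd d} = (\<Union>e\<in>{e. e dvd d}. {r. r < L \<and> period n L r = e})"
    by auto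
  also have "card \<dots> = (\<Sum>e | e dvd d. card {r. r < L \<and> period n L r = e})"
    using assms by (intro card_UN_disjoint) auto
  also have "\<dots> = (\<Sum>e | e dvd d. e * card (zolotarev_cycles n L e))"
    using assms by (intro sum.cong refl card_period_eq) (auto intro: dvd_pos_nat)
  finally show ?thesis .
qed

theorem card_zolotarev_cycles:
  assumes "n > 0" "L > 0" "j > 0"
  shows "real (card (zolotarev_cycles n L j)) =
    1 / real j * (\<Sum>d | d dvd j. real_of_int (moebius (j div d)) * real (gcd (n ^ d - 1) L))"
proof -
  have "(\<Sum>d | d dvd j. real_of_int (moebius (j div d)) * real (gcd (n ^ d - 1) L))
      = real (j * card (zolotarev_cycles n L j))"
  proof (rule moebius_inversion[OF assms(3)])
    fix d assume "d dvd j"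
    then have "d > 0" using assms by (auto intro: dvd_pos_nat)
    then show "real (gcd (n ^ d - 1) L) = (\<Sum>e | e dvd d. real (e * card (zolotarev_cycles n L e)))"
      using assms by (subst gcd_eq_sum_card_cycles) auto
  qed
  then show ?thesis using assms by simp
qed

text \<open>The divisors of \<open>L\<close> coprime to \<open>n\<close> are closed under least common multiples, so the largest of
  them in size is also the largest in the divisibility order.\<close>

lemma
  assumes "L > 0"
  shows coprime_coprime_part: "coprime (coprime_part L n) n"
    and coprime_dvd_coprime_part: "d dvd L \<Longrightarrow> coprime d n \<Longrightarrow> d dvd coprime_part L n"
proof -
  define D where "D = {d. d dvd L \<and> coprime d n}"
  define M where "M = coprime_part L n"
  have fin: "finite D"
    using assms unfolding D_def by simp
  have "1 \<in> D" by (simp add: D_def)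
  then have M: "M \<in> D" "\<And>x. x \<in> D \<Longrightarrow> x \<le> M"
    unfolding M_def coprime_part_def D_def[symmetric] using fin by (blast intro: Max_in Max_ge)+
  show "coprime (coprime_part L n) n"
    using M(1) by (simp add: D_def M_def)
  assume d: "d dvd L" "coprime d n"
  have "coprime (lcm d M) n"
  proof -
    have "coprime (d * M) n" using M(1) d by (simp add: D_def)
    moreover have "lcm d M dvd d * M" by (simp add: lcm_least)
    ultimately show ?thesis by (meson coprime_divisors dvd_refl)
  qed
  then have "lcm d M \<in> D" using M(1) d by (simp add: D_def)
  then have "lcm d M \<le> M" using M by blast
  moreover have "lcm d M > 0"
    using M(1) d assms by (intro lcm_pos_nat) (auto simp: D_def intro: dvd_pos_nat)
  ultimately have "lcm d M = M"
    by (meson dvd_imp_le dvd_lcm2 le_antisym)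
  then show "d dvd coprime_part L n" by (metis M_def dvd_lcm1)
qed

lemma period_dvd_ord_coprime_part:
  assumes "L > 0" "period n L r > 0"
  shows "period n L r dvd ord (coprime_part L n) n"
proof -
  have "coprime (L div gcd r L) n"
    using assms by (simp add: period_def)
  then have "L div gcd r L dvd coprime_part L n"
    using assms by (intro coprime_dvd_coprime_part) (simp_all add: div_dvd_iff_mult)
  moreover have "[n ^ ord (coprime_part L n) n = 1] (mod coprime_part L n)"
    using ord_works by blast
  ultimately have "[n ^ ord (coprime_part L n) n = 1] (mod L div gcd r L)"
    by (rule cong_dvd_modulus_nat[rotated])
  then show ?thesis by (simp add: ord_divides' period_def)
qed


section \<open>Rationality of quasi-periodic series\<close>

text \<open>The quotient rule. The operator \<open>x d/dx\<close> multiplies the \<open>k\<close>-th coefficient by \<open>k\<close>, so iterating it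
  introduces the factors \<open>k ^ e\<close>.\<close>

lemma rational_at_0_X_deriv:
  assumes "f \<in> rational_at_0"
  shows "fps_X * fps_deriv f \<in> rational_at_0"
proof -
  obtain p q :: "complex poly" where q: "poly q 0 \<noteq> 0" and f: "f * fps_of_poly q = fps_of_poly p"
    using assms unfolding rational_at_0_iff by blast
  have d: "fps_deriv f * fps_of_poly q + f * fps_of_poly (pderiv q) = fps_of_poly (pderiv p)"
    using arg_cong[OF f, of fps_deriv] by (simp add: fps_of_poly_pderiv algebra_simps)
  have "fps_X * fps_deriv f * fps_of_poly (q * q)
      = fps_X * ((fps_deriv f * fps_of_poly q) * fps_of_poly q)"
    by (simp add: fps_of_poly_mult algebra_simps)
  also have "fps_deriv f * fps_of_poly q = fps_of_poly (pderiv p) - f * fps_of_poly (pderiv q)"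
    using d by (simp add: algebra_simps)
  also have "fps_X * (\<dots> * fps_of_poly q)
      = fps_X * (fps_of_poly (pderiv p) * fps_of_poly q - f * fps_of_poly q * fps_of_poly (pderiv q))"
    by (simp add: algebra_simps)
  also have "\<dots> = fps_of_poly (Polynomial.monom 1 1 * (pderiv p * q - p * pderiv q))"
    by (simp add: f fps_of_poly_mult fps_of_poly_diff fps_of_poly_monom)
  finally show ?thesis
    unfolding rational_at_0_iff using q
    by (intro exI[of _ "Polynomial.monom 1 1 * (pderiv p * q - p * pderiv q)"] exI[of _ "q * q"]) simp
qed

text \<open>Multiplying by \<open>1 - x ^ L\<close> cancels everything beyond the first period.\<close>

lemma rational_at_0_periodic:
  assumes "L > 0" "\<And>k. a (k + L) = a k"
  shows "Abs_fps a \<in> rational_at_0"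
proof -
  have "Abs_fps a * fps_of_poly (1 - Polynomial.monom 1 L) = fps_of_poly (Poly (map a [0..<L]))"
  proof (rule fps_ext)
    fix k
    have "fps_nth (Abs_fps a * fps_of_poly (1 - Polynomial.monom 1 L)) k = a k - (if k < L then 0 else a (k - L))"
      by (simp add: fps_of_poly_diff fps_of_poly_monom right_diff_distrib fps_X_power_mult_right_nth)
    also have "\<dots> = fps_nth (fps_of_poly (Poly (map a [0..<L]))) k"
      using assms(2)[of "k - L"] by (cases "k < L") (simp_all add: nth_default_def)
    finally show "fps_nth (Abs_fps a * fps_of_poly (1 - Polynomial.monom 1 L)) k
        = fps_nth (fps_of_poly (Poly (map a [0..<L]))) k" .
  qed
  moreover have "poly (1 - Polynomial.monom 1 L) (0::complex) \<noteq> 0"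
    using assms by (simp add: poly_monom power_0_left)
  ultimately show ?thesis
    unfolding rational_at_0_iff by blast
qed

lemma rational_at_0_quasi_periodic:
  assumes "L > 0" "\<And>k. a (k + L) = a k"
  shows "Abs_fps (\<lambda>k. of_nat k ^ e * a k) \<in> rational_at_0"
proof (induction e)
  case 0
  then show ?case using rational_at_0_periodic[of L a] assms by simp
next
  case (Suc e)
  have "Abs_fps (\<lambda>k. of_nat k ^ Suc e * a k)
      = fps_X * fps_deriv (Abs_fps (\<lambda>k. of_nat k ^ e * a k))"
    by (rule fps_ext) (simp add: algebra_simps)
  then show ?case using rational_at_0_X_deriv[OF Suc] by simp
qed


section \<open>The eigenspace in terms of periodic sequences\<close>

lemma periodic_cong:
  fixes a :: "nat \<Rightarrow> 'a"
  assumes "\<And>k. a (k + L) = a k" "[x = y] (mod L)"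
  shows "a x = a y"
proof -
  have *: "a (k + i * L) = a k" for k i
    by (induction i) (simp_all add: assms(1) add.assoc[symmetric] add.left_commute[of _ L] add.commute[of L])
  have "a x = a (x mod L)" for x
    using *[of "x mod L" "x div L"] by simp
  from this[of x] this[of y] assms(2) show ?thesis by (simp add: cong_def)
qed

definition eigensequences :: "nat \<Rightarrow> complex \<Rightarrow> nat \<Rightarrow> (nat \<Rightarrow> complex) set" where
  "eigensequences n \<omega> L = {a. (\<forall>k. a (k + L) = a k) \<and> (\<forall>k. a (n * k) = \<omega> * a k)}"

lemma eigensequence_power:
  assumes "a \<in> eigensequences n \<omega> L"
  shows "a (n ^ t * k) = \<omega> ^ t * a k"
  using assms by (induction t) (auto simp: eigensequences_def mult.assoc)

text \<open>Comparing coefficients at \<open>k > 0\<close> gives \<open>a (n * k) = \<omega> * a k\<close>. At \<open>k = 0\<close> both coefficients vanish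
  if \<open>\<kappa> > 1\<close> and the comparison is void; there the equation is inherited from \<open>k = L\<close> by
  periodicity.\<close>

theorem eigenspace_eq_image:
  assumes "n > 0" "L > 0"
  shows "eigenspace n \<omega> L \<kappa> =
    (\<lambda>a. Abs_fps (\<lambda>k. of_nat k ^ (\<kappa> - 1) * a k)) ` eigensequences n \<omega> L"
proof (intro equalityI subsetI)
  fix f assume f: "f \<in> eigenspace n \<omega> L \<kappa>"
  then obtain a where fa: "f = Abs_fps (\<lambda>k. of_nat k ^ (\<kappa> - 1) * a k)"
    and per: "\<And>k. a (k + L) = a k"
    by (auto simp: eigenspace_def quasi_periodic_def)
  have "U n f = fps_const (of_nat n ^ (\<kappa> - 1) * \<omega>) * f"
    using f by (simp add: eigenspace_def)
  then have eq: "(of_nat (n * k)) ^ (\<kappa> - 1) * a (n * k)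
      = of_nat n ^ (\<kappa> - 1) * \<omega> * (of_nat k ^ (\<kappa> - 1) * a k)" for k
    by (simp add: U_def fa fps_eq_iff)
  have pos: "a (n * k) = \<omega> * a k" if "k > 0" for k
    using eq[of k] that assms by (simp add: power_mult_distrib)
  have "a (n * k) = \<omega> * a k" for k
  proof -
    have "a (n * k) = a (n * (k + L))"
      by (rule periodic_cong[of a L]) (simp_all add: per cong_def algebra_simps)
    also have "\<dots> = \<omega> * a k" using pos[of "k + L"] assms by (simp add: per)
    finally show ?thesis .
  qed
  then show "f \<in> (\<lambda>a. Abs_fps (\<lambda>k. of_nat k ^ (\<kappa> - 1) * a k)) ` eigensequences n \<omega> L"
    using fa per by (auto simp: eigensequences_def)
next
  fix f assume "f \<in> (\<lambda>a. Abs_fps (\<lambda>k. of_nat k ^ (\<kappa> - 1) * a k)) ` eigensequences n \<omega> L"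
  then obtain a where fa: "f = Abs_fps (\<lambda>k. of_nat k ^ (\<kappa> - 1) * a k)"
    and per: "\<And>k. a (k + L) = a k" and eig: "\<And>k. a (n * k) = \<omega> * a k"
    by (auto simp: eigensequences_def)
  have "f \<in> rational_at_0"
    unfolding fa using assms per by (intro rational_at_0_quasi_periodic)
  moreover have "U n f = fps_const (of_nat n ^ (\<kappa> - 1) * \<omega>) * f"
    by (simp add: U_def fa fps_eq_iff eig power_mult_distrib)
  ultimately show "f \<in> eigenspace n \<omega> L \<kappa>"
    using fa per by (auto simp: eigenspace_def quasi_periodic_def)
qed


section \<open>A basis indexed by cycles\<close>

text \<open>Vectors \<open>b i\<close> together with dual functionals \<open>\<phi> i\<close> that separate the points of \<open>V\<close> form a basis:
  subtracting \<open>\<Sum>i\<in>I. \<phi> i x *s b i\<close> from \<open>x\<close> leaves a vector killed by all \<open>\<phi> i\<close>.\<close>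

lemma (in vector_space) dim_eq_card_dual_family:
  assumes V: "subspace V" and I: "finite I"
    and b: "\<And>i. i \<in> I \<Longrightarrow> b i \<in> V"
    and \<phi>: "\<And>i. i \<in> I \<Longrightarrow> module_hom scale (*) (\<phi> i)"
    and dual: "\<And>i j. i \<in> I \<Longrightarrow> j \<in> I \<Longrightarrow> \<phi> i (b j) = (if i = j then 1 else 0)"
    and separating: "\<And>x. x \<in> V \<Longrightarrow> (\<And>i. i \<in> I \<Longrightarrow> \<phi> i x = 0) \<Longrightarrow> x = 0"
  shows "dim V = card I"
proof -
  have coord: "\<phi> i (\<Sum>j\<in>I. scale (u j) (b j)) = u i" if i: "i \<in> I" for i u
  proof -
    interpret \<phi>: module_hom scale "(*)" "\<phi> i" by (rule \<phi>[OF i])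
    have "\<phi> i (\<Sum>j\<in>I. scale (u j) (b j)) = (\<Sum>j\<in>I. u j * (if i = j then 1 else 0))"
      using i by (simp add: \<phi>.sum \<phi>.scale dual)
    then show ?thesis using i I by (simp add: if_distrib sum.delta' cong: if_cong)
  qed
  have inj: "inj_on b I"
    by (rule inj_onI) (metis dual zero_neq_one)
  have "independent (b ` I)"
  proof (rule independent_if_scalars_zero)
    show "finite (b ` I)" using I by simp
    fix u x assume sum: "(\<Sum>x\<in>b ` I. scale (u x) x) = 0" and "x \<in> b ` I"
    then obtain i where i: "i \<in> I" "x = b i" by blast
    have "(\<Sum>j\<in>I. scale (u (b j)) (b j)) = 0"
      using sum inj by (simp add: sum.reindex)
    moreover have "\<phi> i 0 = 0"
      using coord[OF i(1), of "\<lambda>_. 0"] by simp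
    ultimately show "u x = 0"
      using coord[OF i(1), of "\<lambda>j. u (b j)"] i by simp
  qed
  moreover have "V \<subseteq> span (b ` I)"
  proof
    fix x assume x: "x \<in> V"
    define y where "y = (\<Sum>i\<in>I. scale (\<phi> i x) (b i))"
    have "y \<in> V" unfolding y_def using b V by (intro subspace_sum subspace_scale)
    moreover have "\<phi> i (x - y) = 0" if i: "i \<in> I" for i
      using module_hom.diff[OF \<phi>[OF i]] coord[OF i] by (simp add: y_def)
    ultimately have "x - y = 0"
      using x V by (intro separating subspace_diff)
    moreover have "y \<in> span (b ` I)"
      unfolding y_def by (intro span_sum span_scale span_base imageI)
    ultimately show "x \<in> span (b ` I)" by simp
  qed
  moreover have "b ` I \<subseteq> V" using b by blast
  ultimately have "card (b ` I) = dim V" by (intro basis_card_eq_dim)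
  then show ?thesis using inj by (simp add: card_image)
qed

lemma primitive_root_power_eq_1_iff:
  assumes "primitive_root_of_unity m \<omega>"
  shows "\<omega> ^ j = 1 \<longleftrightarrow> m dvd j"
proof -
  have m: "m > 0" "\<omega> ^ m = 1" "\<And>k. 0 < k \<Longrightarrow> k < m \<Longrightarrow> \<omega> ^ k \<noteq> 1"
    using assms by (auto simp: primitive_root_of_unity_def)
  have "\<omega> ^ j = \<omega> ^ (m * (j div m) + j mod m)" by simp
  also have "\<dots> = \<omega> ^ (j mod m)"
    by (simp only: power_add power_mult m power_one mult_1)
  finally have "\<omega> ^ j = \<omega> ^ (j mod m)" .
  moreover have "j mod m < m" using m by simp
  ultimately show ?thesis
    using m(3)[of "j mod m"] by (cases "j mod m = 0") (auto simp: dvd_eq_mod_eq_0)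
qed

lemma root_of_unity_power_cong:
  fixes z :: "'a::monoid_mult"
  assumes "z ^ m = 1" "[s = t] (mod m)"
  shows "z ^ s = z ^ t"
proof -
  have "z ^ s = z ^ (s mod m)" for s
  proof -
    have "z ^ s = z ^ (m * (s div m) + s mod m)" by simp
    also have "\<dots> = z ^ (s mod m)"
      by (simp only: power_add power_mult assms(1) power_one mult_1_left)
    finally show ?thesis .
  qed
  from this[of s] this[of t] assms(2) show ?thesis by (simp add: cong_def)
qed

text \<open>The value \<open>1\<close> at \<open>r\<close>, transported backwards along the edges of the graph. Different walks from \<open>k\<close>
  to \<open>r\<close> have lengths that differ by multiples of the period of \<open>r\<close>, so the choice of \<open>t\<close> does not
  matter if the power of \<open>\<omega>\<close> with this exponent is \<open>1\<close>.\<close>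

definition cycle_sequence :: "nat \<Rightarrow> complex \<Rightarrow> nat \<Rightarrow> nat \<Rightarrow> nat \<Rightarrow> complex" where
  "cycle_sequence n \<omega> L r k =
     (if \<exists>t. [n ^ t * k = r] (mod L) then inverse \<omega> ^ (SOME t. [n ^ t * k = r] (mod L)) else 0)"

lemma cycle_sequence_eq:
  assumes "L > 0" "period n L r > 0" "\<omega> ^ period n L r = 1" "[n ^ t * k = r] (mod L)"
  shows "cycle_sequence n \<omega> L r k = inverse \<omega> ^ t"
proof -
  define s where "s = (SOME t. [n ^ t * k = r] (mod L))"
  have s: "[n ^ s * k = r] (mod L)"
    unfolding s_def by (rule someI[of _ t]) (rule assms(4))
  have "[n ^ s * (n ^ t * k) = n ^ s * r] (mod L)" "[n ^ t * (n ^ s * k) = n ^ t * r] (mod L)"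
    using assms(4) s by (auto intro: cong_scalar_left)
  then have "[n ^ s * r = n ^ t * r] (mod L)"
    by (simp add: cong_def mult.left_commute)
  then have "[s = t] (mod period n L r)"
    using assms by (simp add: power_mult_cong_iff)
  then have "inverse \<omega> ^ s = inverse \<omega> ^ t"
    using assms(3) by (intro root_of_unity_power_cong) (simp_all add: power_inverse)
  then show ?thesis
    using assms(4) by (auto simp: cycle_sequence_def s_def[symmetric])
qed

lemma cycle_sequence_eigensequence:
  assumes "L > 0" "period n L r > 0" "\<omega> ^ period n L r = 1"
  shows "cycle_sequence n \<omega> L r \<in> eigensequences n \<omega> L"
proof -
  have \<omega>: "\<omega> \<noteq> 0" using assms by (intro notI) (simp add: power_0_left)
  have "[n ^ t * (k + L) = r] (mod L) \<longleftrightarrow> [n ^ t * k = r] (mod L)" for t k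
    by (simp add: cong_def distrib_left)
  then have "cycle_sequence n \<omega> L r (k + L) = cycle_sequence n \<omega> L r k" for k
    by (simp add: cycle_sequence_def)
  moreover have "cycle_sequence n \<omega> L r (n * k) = \<omega> * cycle_sequence n \<omega> L r k" for k
  proof (cases "\<exists>t. [n ^ t * (n * k) = r] (mod L)")
    case True
    then obtain t where t: "[n ^ t * (n * k) = r] (mod L)" by blast
    then have "[n ^ Suc t * k = r] (mod L)" by (simp add: mult_ac)
    then show ?thesis
      using cycle_sequence_eq[OF assms t] cycle_sequence_eq[OF assms, of "Suc t" k] \<omega> by simp
  next
    case False
    have "\<not> [n ^ t * k = r] (mod L)" for t
    proof
      assume t: "[n ^ t * k = r] (mod L)"
      define p where "p = period n L r"
      \<comment> \<open>If \<open>k\<close> reaches \<open>r\<close>, so does \<open>n * k\<close>: going once more round the cycle makes the walk nonempty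
        even for \<open>t = 0\<close>, and its first step leads to \<open>n * k\<close>.\<close>
      have "[n ^ p * (n ^ t * k) = n ^ p * r] (mod L)"
        using t by (rule cong_scalar_left)
      also have "[n ^ p * r = r] (mod L)"
        using assms by (simp add: power_fixes_iff_period_dvd p_def)
      also have "n ^ p * (n ^ t * k) = n ^ (p + t - 1) * (n * k)"
        using assms by (cases p) (simp_all add: p_def power_add mult_ac)
      finally show False using False by blast
    qed
    with False show ?thesis by (simp add: cycle_sequence_def)
  qed
  ultimately show ?thesis by (simp add: eigensequences_def)
qed

text \<open>The residue \<open>k\<close> runs into a cycle at some \<open>x\<close>, and \<open>a x\<close> is a nonzero multiple of \<open>a k\<close>. If the
  product of \<open>\<omega>\<close> around this cycle is not \<open>1\<close>, then \<open>a x = 0\<close> since the walk returns to \<open>x\<close>; otherwise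
  the zero of \<open>a\<close> on the cycle propagates to \<open>x\<close>.\<close>

lemma eigensequence_eq_0:
  assumes "L > 0" "\<omega> \<noteq> 0" "a \<in> eigensequences n \<omega> L"
    and zero: "\<And>x. x < L \<Longrightarrow> period n L x > 0 \<Longrightarrow> \<omega> ^ period n L x = 1 \<Longrightarrow> \<exists>y\<in>orbit n L x. a y = 0"
  shows "a k = 0"
proof -
  have per: "\<And>k. a (k + L) = a k" using assms by (simp add: eigensequences_def)
  obtain t where t: "period n L (n ^ t * k) > 0"
    using eventually_cyclic assms by blast
  define x where "x = n ^ t * k mod L"
  have xc: "[x = n ^ t * k] (mod L)" by (simp add: x_def)
  have x: "x < L" "period n L x > 0"
    using assms t by (simp_all add: x_def period_def)
  have ax: "a x = \<omega> ^ t * a k"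
    using periodic_cong[of a, OF per xc] eigensequence_power[OF assms(3)] by simp
  have "a x = 0"
  proof (cases "\<omega> ^ period n L x = 1")
    case True
    then obtain y where y: "y \<in> orbit n L x" "a y = 0" using zero x by blast
    then obtain i where "[y = n ^ i * x] (mod L)" using x assms by (auto simp: mem_orbit_iff)
    then have "a y = \<omega> ^ i * a x"
      using periodic_cong[of a, OF per] eigensequence_power[OF assms(3)] by metis
    then show ?thesis using y assms by simp
  next
    case False
    have "[n ^ period n L x * x = x] (mod L)"
      using assms by (simp add: power_fixes_iff_period_dvd)
    then have "\<omega> ^ period n L x * a x = a x"
      using periodic_cong[of a, OF per] eigensequence_power[OF assms(3)] by metis
    then show ?thesis using False by simp
  qed
  then show ?thesis using ax assms by simp
qed

text \<open>The basis consists of the series of the \<open>cycle_sequence\<close>s at one residue per cycle of length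
  divisible by \<open>m\<close>; the least element of the cycle serves as this residue. The dual functionals are
  the evaluations of \<open>a\<close> at these residues.\<close>

theorem dim_eigenspace:
  assumes "n > 0" "L > 0" and prim: "primitive_root_of_unity m \<omega>"
  shows "fps_space.dim (eigenspace n \<omega> L \<kappa>) =
    card (orbit n L ` {r. r < L \<and> period n L r > 0 \<and> m dvd period n L r})"
proof -
  define \<C> where "\<C> = orbit n L ` {r. r < L \<and> period n L r > 0 \<and> m dvd period n L r}"
  define \<Phi> where "\<Phi> = (\<lambda>a :: nat \<Rightarrow> complex. Abs_fps (\<lambda>k. of_nat k ^ (\<kappa> - 1) * a k))"
  \<comment> \<open>\<open>\<phi> C\<close> recovers \<open>a (Min C)\<close> from the series. The shift by \<open>L\<close> leaves \<open>a\<close> unchanged and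
    avoids the index \<open>0\<close>, where the factor \<open>k ^ (\<kappa> - 1)\<close> can vanish.\<close>
  define \<phi> :: "nat set \<Rightarrow> complex fps \<Rightarrow> complex"
    where "\<phi> C f = fps_nth f (Min C + L) / of_nat (Min C + L) ^ (\<kappa> - 1)" for C f
  define b where "b C = \<Phi> (cycle_sequence n \<omega> L (Min C))" for C
  have \<omega>: "\<omega> \<noteq> 0"
    using prim by (auto simp: primitive_root_of_unity_def power_0_left)
  have rep: "Min C < L" "period n L (Min C) > 0" "\<omega> ^ period n L (Min C) = 1"
      "C = orbit n L (Min C)" if C: "C \<in> \<C>" for C
  proof -
    obtain r where r: "r < L" "period n L r > 0" "m dvd period n L r" "C = orbit n L r"
      using C by (auto simp: \<C>_def)
    have Min: "Min C \<in> orbit n L r"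
      unfolding r(4) using r by (intro Min_in) (auto simp: orbit_def)
    then have per: "period n L (Min C) = period n L r"
      using mem_orbit_iff[OF assms(2) r(2)] period_power_mult[OF assms(2) r(2)] by blast
    show "Min C < L" "period n L (Min C) > 0" "\<omega> ^ period n L (Min C) = 1"
      "C = orbit n L (Min C)"
      using Min r mem_orbit_iff[OF assms(2) r(2)] orbit_eq_of_mem[OF assms(2) r(2) Min] per
      by (simp_all add: primitive_root_power_eq_1_iff[OF prim])
  qed
  have eig: "eigenspace n \<omega> L \<kappa> = \<Phi> ` eigensequences n \<omega> L"
    unfolding \<Phi>_def using assms by (intro eigenspace_eq_image)
  have \<phi>_\<Phi>: "\<phi> C (\<Phi> a) = a (Min C)" if "a \<in> eigensequences n \<omega> L" for C a
  proof -
    have "(of_nat (Min C + L) :: complex) \<noteq> 0"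
      using assms by (simp only: of_nat_eq_0_iff)
    then show ?thesis
      using that unfolding \<phi>_def \<Phi>_def eigensequences_def
      by (simp del: of_nat_add of_nat_eq_0_iff)
  qed
  have "fps_space.dim (eigenspace n \<omega> L \<kappa>) = card \<C>"
  proof (rule fps_space.dim_eq_card_dual_family[where b = b and \<phi> = \<phi>])
    show "fps_space.subspace (eigenspace n \<omega> L \<kappa>)" by (rule subspace_eigenspace)
    show "finite \<C>" by (simp add: \<C>_def)
    show "b C \<in> eigenspace n \<omega> L \<kappa>" if "C \<in> \<C>" for C
      unfolding eig b_def using that rep assms by (intro imageI cycle_sequence_eigensequence)
    show "module_hom (\<lambda>c f. fps_const c * f) (*) (\<phi> C)" for C
      unfolding module_hom_iff
    proof (intro conjI allI)
      show "Modules.module ((*) :: complex \<Rightarrow> _)"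
        by unfold_locales (simp_all add: algebra_simps)
    qed (simp_all add: fps_space.module_axioms \<phi>_def add_divide_distrib)
    show "\<phi> C (b D) = (if C = D then 1 else 0)" if C: "C \<in> \<C>" and D: "D \<in> \<C>" for C D
    proof -
      have "\<phi> C (b D) = cycle_sequence n \<omega> L (Min D) (Min C)"
        unfolding b_def using D rep assms by (intro \<phi>_\<Phi> cycle_sequence_eigensequence)
      also have "\<dots> = (if C = D then 1 else 0)"
      proof (cases "C = D")
        case True
        then show ?thesis
          using cycle_sequence_eq[of L n "Min D" \<omega> 0 "Min C"] rep D assms by simp
      next
        case False
        have "\<not> [n ^ t * Min C = Min D] (mod L)" for t
        proof
          assume "[n ^ t * Min C = Min D] (mod L)"
          then have "Min D \<in> orbit n L (Min C)"
            using rep[OF C] rep[OF D] assms by (auto simp: mem_orbit_iff cong_sym_eq)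
          then have "orbit n L (Min D) = orbit n L (Min C)"
            using rep[OF C] assms by (intro orbit_eq_of_mem)
          with False rep[OF C] rep[OF D] show False by simp
        qed
        then show ?thesis using False by (simp add: cycle_sequence_def)
      qed
      finally show ?thesis .
    qed
    show "f = 0" if f: "f \<in> eigenspace n \<omega> L \<kappa>" and vanish: "\<And>C. C \<in> \<C> \<Longrightarrow> \<phi> C f = 0" for f
    proof -
      obtain a where a: "a \<in> eigensequences n \<omega> L" "f = \<Phi> a" using f eig by blast
      have "a k = 0" for k
      proof (rule eigensequence_eq_0[OF assms(2) \<omega> a(1)])
        fix x assume x: "x < L" "period n L x > 0" "\<omega> ^ period n L x = 1"
        then have C: "orbit n L x \<in> \<C>"
          by (auto simp: \<C>_def primitive_root_power_eq_1_iff[OF prim])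
        have "Min (orbit n L x) \<in> orbit n L x"
          using x self_mem_orbit[of x L n] by (intro Min_in) (auto simp: orbit_def)
        moreover have "a (Min (orbit n L x)) = 0"
          using vanish[OF C] \<phi>_\<Phi>[OF a(1)] a by simp
        ultimately show "\<exists>y\<in>orbit n L x. a y = 0" by blast
      qed
      then show ?thesis using a by (simp add: \<Phi>_def fps_eq_iff)
    qed
  qed
  then show ?thesis by (simp add: \<C>_def)
qed

text \<open>A cycle of length \<open>i * m\<close> satisfies \<open>i \<le> i * m \<le> c\<close>, as its length divides
  \<open>c = ord (coprime_part L n) n\<close>; hence the bound \<open>c\<close> on \<open>i\<close> loses nothing.\<close>

lemma cycles_length_multiple_eq_Union:
  assumes "L > 0" "m > 0"
  shows "orbit n L ` {r. r < L \<and> period n L r > 0 \<and> m dvd period n L r} =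
    (\<Union>j\<in>{1..ord (coprime_part L n) n}. zolotarev_cycles n L (j * m))" (is "?A = ?B")
proof (intro equalityI subsetI)
  fix C assume "C \<in> ?A"
  then obtain r where r: "r < L" "period n L r > 0" "m dvd period n L r" "C = orbit n L r"
    by blast
  then obtain i where i: "period n L r = i * m" by (metis dvdE mult.commute)
  have "period n L r dvd ord (coprime_part L n) n"
    using period_dvd_ord_coprime_part assms r by blast
  moreover have "ord (coprime_part L n) n > 0"
    using assms coprime_coprime_part by simp
  ultimately have "i * m \<le> ord (coprime_part L n) n" using i dvd_imp_le by metis
  moreover have "i \<le> i * m" using assms by simp
  ultimately have "i \<le> ord (coprime_part L n) n" by (rule order_trans[rotated])
  moreover have "i > 0" using i r by (auto intro!: Nat.gr0I)
  moreover have "C \<in> zolotarev_cycles n L (i * m)"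
    using assms i r by (subst zolotarev_cycles_eq_orbits) auto
  ultimately show "C \<in> ?B" by (intro UN_I[of i]) simp_all
next
  fix C assume "C \<in> ?B"
  then obtain j where j: "j \<ge> 1" "C \<in> zolotarev_cycles n L (j * m)" by auto
  then show "C \<in> ?A"
    using assms by (subst (asm) zolotarev_cycles_eq_orbits) auto
qed

theorem theorem12:
  fixes n L \<kappa> c m :: nat and \<omega> :: complex
  assumes "n > 0" and "L > 0" and "\<kappa> > 0"
    and "c = ord (coprime_part L n) n"
    and "m > 0" and "m dvd c"
    and "primitive_root_of_unity m \<omega>"
  shows "fps_space.dim (eigenspace n \<omega> L \<kappa>) = (\<Sum>j = 1..c. card (zolotarev_cycles n L (j * m))) \<and>
    (\<forall>j > 0. real (card (zolotarev_cycles n L j)) =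
       1 / real j * (\<Sum>d | d dvd j. real_of_int (moebius (j div d)) * real (gcd (n ^ d - 1) L)))"
proof
  have "fps_space.dim (eigenspace n \<omega> L \<kappa>) =
      card (\<Union>j\<in>{1..c}. zolotarev_cycles n L (j * m))"
    using assms by (simp add: dim_eigenspace cycles_length_multiple_eq_Union)
  also have "\<dots> = (\<Sum>j = 1..c. card (zolotarev_cycles n L (j * m)))"
  proof (rule card_UN_disjoint)
    show "\<forall>j\<in>{1..c}. finite (zolotarev_cycles n L (j * m))"
      using assms by (auto intro: finite_zolotarev_cycles)
    have "zolotarev_cycles n L i \<inter> zolotarev_cycles n L j = {}" if "i \<noteq> j" for i j
      using that by (auto simp: zolotarev_cycles_def)
    then show "\<forall>i\<in>{1..c}. \<forall>j\<in>{1..c}. i \<noteq> j \<longrightarrow>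
        zolotarev_cycles n L (i * m) \<inter> zolotarev_cycles n L (j * m) = {}"
      using assms by simp
  qed simp
  finally show "fps_space.dim (eigenspace n \<omega> L \<kappa>) = (\<Sum>j = 1..c. card (zolotarev_cycles n L (j * m)))" .
  show "\<forall>j > 0. real (card (zolotarev_cycles n L j)) =
       1 / real j * (\<Sum>d | d dvd j. real_of_int (moebius (j div d)) * real (gcd (n ^ d - 1) L))"
    using card_zolotarev_cycles assms by blast
qed

end
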